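(* Let $\mathbb{K}$ be a field of characteristic zero and $q\in\mathbb{K}\setminus\{0\}$ not a root of unity. Let $b\in\mathbb{K}[x]\setminus\{0\}$, $a\in\mathbb{K}[x,y]$, let $m,j,\lambda$ be positive integers and $n,v\in\mathbb{Z}$, with $\deg_y(a)<\lambda$. Let $(A(x),B(x),C(x))$ be an $m$-fold $q$-Gosper representation of $\frac{b(x)}{b(xq^m)}$, i.e. $A,B,C\in\mathbb{K}[x]$ with \[ \frac{b(x)}{b(xq^m)}=\frac{A(x)}{B(x)}\cdot\frac{C(xq^m)}{C(x)}\quad\text{and}\quad \gcd\big(A(x),B(xq^{hm})\big)=1\ \text{ for all } h\in\mathbb{N}. \] Write \[ b(x)=\sum_{k=\ell_0'}^{\ell_0}\beta_kx^k,\quad A(x)=\sum_{k=\ell_1'}^{\ell_1}a_kx^k,\quad B(x)=\sum_{k=\ell_1'}^{\ell_1}b_kx^k,\quad C(x)=\sum_{k=\ell_2'}^{\ell_2}c_kx^k,\quad a(x,y)=\sum_{k=\ell_3'}^{\ell_3}\alpha_k(y)x^k, \] where $\ell_i,\ell_i'$ are the highest and lowest degrees in $x$ of these polynomials (the highest and lowest $x$-degrees of $A$ and $B$ coincide). Suppose $\hat{p}(x,y)=\sum_{k=\ell'}^{\ell}p_k(y)x^k$, with $p_k\in\mathbb{K}[y]$, $p_\ell\neq0$, $p_{\ell'}\neq 0$, $\ell,\ell'\in\mathbb{Z}$, is a Laurent polynomial in $x$ with $\deg_y(\hat p)<\lambda$ satisfying \[ a(x,y)C(x)=q^{-vj}A(x)\,\hat{p}(xq^m,yq^{-n})-B(xq^{-m})\,\hat{p}(x,y).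 \] Then \[ \ell\le \max\left\{\ell_2+\ell_3-\ell_1,\ \ell_0-\ell_1+\ell_2+\frac{vj}{m},\ \ell_0-\ell_1+\ell_2+\frac{vj+n(\lambda-1)}{m}\right\} \] and \[ \ell'\ge \min\left\{\ell_2'+\ell_3'-\ell_1',\ \ell_0'-\ell_1'+\ell_2'+\frac{vj}{m},\ \ell_0'-\ell_1'+\ell_2'+\frac{vj+n(\lambda-1)}{m}\right\}. \]
   Context: $\mathbb{N}=\{0,1,2,\dots\}$. For a Laurent polynomial in $x$ (with coefficients in $\mathbb{K}[y]$), the highest and lowest degrees are the largest and smallest exponents of $x$ with nonzero coefficient. *)

theory Defs
  imports
    Complex_Main
    "HOL-Library.Poly_Mapping"
    "HOL-Library.Extended_Real"
    "HOL-Computational_Algebra.Computational_Algebra"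
begin

(* Elements of K[x] have type 'a poly.  Elements of K[x,y] = K[y][x] have type 'a poly poly,
   the outer variable being x.  The ring K[y][x,1/x] of Laurent polynomials in x over K[y] is
   the group ring of the integers over K[y]. *)

type_synonym 'a laurent = "int \<Rightarrow>\<^sub>0 'a poly"

definition laurent_of_poly2 :: "'a::zero poly poly \<Rightarrow> 'a laurent" where
  "laurent_of_poly2 p =
     Abs_poly_mapping (\<lambda>k. if k < 0 then 0 else poly.coeff p (nat k))"

definition laurent_of_poly :: "'a::zero poly \<Rightarrow> 'a laurent" where
  "laurent_of_poly p = laurent_of_poly2 (map_poly (\<lambda>c. [:c:]) p)"

lemma lookup_laurent_of_poly2:
  "Poly_Mapping.lookup (laurent_of_poly2 p) k = (if k < 0 then 0 else poly.coeff p (nat k))"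
proof -
  have "{k. (if k < 0 then 0 else poly.coeff p (nat k)) \<noteq> 0} \<subseteq> int ` {..Polynomial.degree p}"
  proof
    fix k assume "k \<in> {k. (if k < 0 then 0 else poly.coeff p (nat k)) \<noteq> 0}"
    then have "k \<ge> 0" "poly.coeff p (nat k) \<noteq> 0"
      by (auto split: if_splits)
    then have "nat k \<le> Polynomial.degree p" "k = int (nat k)"
      by (auto intro: le_degree)
    then show "k \<in> int ` {..Polynomial.degree p}"
      by blast
  qed
  then have "finite {k. (if k < 0 then 0 else poly.coeff p (nat k)) \<noteq> 0}"
    using finite_subset by blast
  then show ?thesis
    unfolding laurent_of_poly2_def by (subst lookup_Abs_poly_mapping) auto
qed

lemma lookup_laurent_of_poly:
  "Poly_Mapping.lookup (laurent_of_poly p) k = (if k < 0 then 0 else [:poly.coeff p (nat k):])"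
  by (simp add: laurent_of_poly_def lookup_laurent_of_poly2 coeff_map_poly)

(* The highest and lowest degrees in x, with the conventions -\<infinity> and \<infinity> for the zero polynomial. *)

definition x_highdeg :: "'a::zero laurent \<Rightarrow> ereal" where
  "x_highdeg p = (SUP k\<in>Poly_Mapping.keys p. ereal (of_int k))"

definition x_lowdeg :: "'a::zero laurent \<Rightarrow> ereal" where
  "x_lowdeg p = (INF k\<in>Poly_Mapping.keys p. ereal (of_int k))"

(* The degree in y.  The supremum is taken in nat, so the zero polynomial has degree 0. *)

definition y_degree :: "'a::zero laurent \<Rightarrow> nat" where
  "y_degree p = (SUP k\<in>Poly_Mapping.keys p. Polynomial.degree (Poly_Mapping.lookup p k))"

(* p(s x, t y), for s nonzero *)

definition laurent_scale :: "'a::field \<Rightarrow> 'a \<Rightarrow> 'a laurent \<Rightarrow> 'a laurent" where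
  "laurent_scale s t p =
     (\<Sum>k\<in>Poly_Mapping.keys p.
        Poly_Mapping.single k
          (Polynomial.smult (s powi k) (pcompose (Poly_Mapping.lookup p k) [:0, t:])))"

lemma lookup_laurent_scale:
  "Poly_Mapping.lookup (laurent_scale s t p) k =
     Polynomial.smult (s powi k) (pcompose (Poly_Mapping.lookup p k) [:0, t:])"
  by (cases "k \<in> Poly_Mapping.keys p")
     (auto simp: laurent_scale_def lookup_sum lookup_single when_def in_keys_iff)

(* p(c x) *)

definition x_scale :: "'a::field \<Rightarrow> 'a poly \<Rightarrow> 'a poly" where
  "x_scale c p = pcompose p [:0, c:]"

(* An m-fold q-Gosper representation of b(x) / b(x q^m), for b nonzero.  Since Fract P 0 = 0, the
   fractions only have their meaning for B and C nonzero; the identity then forces A nonzero and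
   the highest (lowest) degrees of A and B to agree. *)

definition q_gosper_rep ::
  "'a::field \<Rightarrow> nat \<Rightarrow> 'a poly \<Rightarrow> 'a poly \<Rightarrow> 'a poly \<Rightarrow> 'a poly \<Rightarrow> bool" where
  "q_gosper_rep q m b A B C \<longleftrightarrow>
     B \<noteq> 0 \<and> C \<noteq> 0 \<and>
     Fract b (x_scale (q ^ m) b) = Fract A B * Fract (x_scale (q ^ m) C) C \<and>
     (\<forall>h::nat. coprime A (x_scale (q ^ (h * m)) B))"

end

theory Submission
  imports Defs
begin

section \<open>Convolution and the embedding of polynomials into Laurent polynomials\<close>

text \<open>Exponents form a group, so \<open>k = l + q\<close> has the single solution
  \<open>q = k - l\<close>, and the double sum defining a product collapses to a single sum.\<close>

lemma lookup_mult_group: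
  fixes P Q :: "'k::ab_group_add \<Rightarrow>\<^sub>0 'b::semiring_0"
  shows "Poly_Mapping.lookup (P * Q) k
           = (\<Sum>l. Poly_Mapping.lookup P l * Poly_Mapping.lookup Q (k - l))"
proof -
  have "(\<Sum>q. Poly_Mapping.lookup Q q when k = l + q) = Poly_Mapping.lookup Q (k - l)" for l
  proof -
    have "(\<Sum>q. Poly_Mapping.lookup Q q when k = l + q)
            = (\<Sum>q. Poly_Mapping.lookup Q q when q = k - l)"
      by (rule Sum_any.cong, rule when_cong) (auto simp: algebra_simps)
    then show ?thesis by simp
  qed
  then show ?thesis
    by (simp add: lookup_mult)
qed

lemma lookup_single_mult:
  fixes Q :: "'k::ab_group_add \<Rightarrow>\<^sub>0 'b::semiring_0"
  shows "Poly_Mapping.lookup (Poly_Mapping.single i c * Q) k = c * Poly_Mapping.lookup Q (k - i)"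
proof -
  have "(\<Sum>l. Poly_Mapping.lookup (Poly_Mapping.single i c) l * Poly_Mapping.lookup Q (k - l))
          = (\<Sum>l. c * Poly_Mapping.lookup Q (k - l) when l = i)"
    by (rule Sum_any.cong) (auto simp: lookup_single when_def)
  then show ?thesis
    by (simp add: lookup_mult_group)
qed

text \<open>Horner induction on \<open>f\<close>: under the embedding, prepending a coefficient
  becomes multiplication by the monomial \<open>single 1 1\<close> plus a constant.\<close>

lemma laurent_of_poly_mult:
  fixes f g :: "'a::comm_ring_1 poly"
  shows "laurent_of_poly (f * g) = laurent_of_poly f * laurent_of_poly g"
proof (induction f)
  case 0
  have "laurent_of_poly (0 :: 'a poly) = 0"
    by (rule poly_mapping_eqI) (simp add: lookup_laurent_of_poly)
  then show ?case by simp
next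
  case (pCons c f)
  have split: "laurent_of_poly (pCons c h)
      = Poly_Mapping.single 0 [:c:] + Poly_Mapping.single 1 1 * laurent_of_poly h"
    for c :: 'a and h
    by (rule poly_mapping_eqI)
      (auto simp: lookup_laurent_of_poly lookup_add lookup_single_mult lookup_single when_def
         coeff_pCons nat_diff_distrib split: nat.splits)
  have smult: "laurent_of_poly (Polynomial.smult c g + h)
      = Poly_Mapping.single 0 [:c:] * laurent_of_poly g + laurent_of_poly h" for h
    by (rule poly_mapping_eqI)
      (auto simp: lookup_laurent_of_poly lookup_add lookup_single_mult)
  have "laurent_of_poly (pCons 0 (f * g))
      = Poly_Mapping.single 1 1 * (laurent_of_poly f * laurent_of_poly g)"
    using split[of 0 "f * g"] pCons.IH by simp
  then show ?case
    by (simp add: smult split algebra_simps)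
qed

section \<open>Ends of the support and their behaviour under products\<close>

text \<open>The sign \<open>e\<close> selects the end of the support: \<open>e = 1\<close> gives the highest and
  \<open>e = -1\<close> the lowest degree, so that both bounds are instances of one argument.\<close>

definition extremal :: "int \<Rightarrow> (int \<Rightarrow>\<^sub>0 'b::zero) \<Rightarrow> int \<Rightarrow> bool" where
  "extremal e P s \<longleftrightarrow>
     Poly_Mapping.lookup P s \<noteq> 0 \<and> (\<forall>k. Poly_Mapping.lookup P k \<noteq> 0 \<longrightarrow> e * k \<le> e * s)"

lemma extremal_unique: "e \<noteq> 0 \<Longrightarrow> extremal e P s \<Longrightarrow> extremal e P t \<Longrightarrow> s = t"
  unfolding extremal_def by (metis mult_cancel_left order_antisym)

text \<open>Only the support matters, so rescaling coefficients by nonzero factors, as the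
  substitutions in x and y do, leaves the ends in place.\<close>

lemma extremal_cong:
  assumes "\<And>k. Poly_Mapping.lookup P k = 0 \<longleftrightarrow> Poly_Mapping.lookup Q k = 0"
  shows "extremal e P s \<longleftrightarrow> extremal e Q s"
  using assms by (simp add: extremal_def)

lemma extremal_exists:
  assumes "P \<noteq> 0"
  shows "\<exists>s. extremal e P s"
proof -
  let ?K = "Poly_Mapping.keys P"
  have "finite ((\<lambda>k. e * k) ` ?K)" "(\<lambda>k. e * k) ` ?K \<noteq> {}"
    using assms by auto
  from Max_in[OF this] obtain s where "s \<in> ?K" "e * s = Max ((\<lambda>k. e * k) ` ?K)"
    by (metis imageE)
  moreover have "e * k \<le> Max ((\<lambda>k. e * k) ` ?K)" if "k \<in> ?K" for k
    using that by (intro Max_ge) auto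
  ultimately show ?thesis
    unfolding extremal_def by (auto simp: in_keys_iff)
qed

text \<open>An attained upper bound of the support is its supremum; this carries integer exponents
  over to the extended reals of the final bounds.\<close>

lemma x_highdeg_extremal: "extremal 1 P s \<Longrightarrow> x_highdeg P = ereal (of_int s)"
  unfolding x_highdeg_def extremal_def
  by (intro antisym SUP_least SUP_upper) (auto simp: in_keys_iff)

lemma x_lowdeg_extremal: "extremal (- 1) P s \<Longrightarrow> x_lowdeg P = ereal (of_int s)"
  unfolding x_lowdeg_def extremal_def
  by (intro antisym INF_greatest INF_lower) (auto simp: in_keys_iff)

text \<open>Any pair of exponents with sum \<open>s + t\<close> other than \<open>(s, t)\<close> has
  a member beyond the end of its factor, so one term survives. It is nonzero because the
  coefficients lie in a domain.\<close>

lemma extremal_mult: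
  fixes P Q :: "int \<Rightarrow>\<^sub>0 'b::idom"
  assumes "e \<noteq> 0" "extremal e P s" "extremal e Q t"
  shows lookup_extremal_mult: "Poly_Mapping.lookup (P * Q) (s + t)
          = Poly_Mapping.lookup P s * Poly_Mapping.lookup Q t"
    and "extremal e (P * Q) (s + t)"
proof -
  have zero: "Poly_Mapping.lookup P l * Poly_Mapping.lookup Q (s + t - l) = 0" if "l \<noteq> s" for l
  proof (rule ccontr)
    assume "\<not> ?thesis"
    then have "e * l \<le> e * s" "e * (s + t - l) \<le> e * t"
      using assms by (auto simp: extremal_def)
    \<comment> \<open>Cancelling \<open>e * t\<close> in the second inequality gives
      \<open>e * s \<le> e * l\<close>, the converse of the first.\<close>
    then have "e * l = e * s"
      by (intro antisym) (simp_all add: distrib_left right_diff_distrib)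
    with that \<open>e \<noteq> 0\<close> show False
      using mult_cancel_left by blast
  qed
  have "(\<Sum>l. Poly_Mapping.lookup P l * Poly_Mapping.lookup Q (s + t - l))
      = (\<Sum>l. Poly_Mapping.lookup P l * Poly_Mapping.lookup Q (s + t - l) when l = s)"
    by (rule Sum_any.cong) (use zero in \<open>auto simp: when_def\<close>)
  then show *: "Poly_Mapping.lookup (P * Q) (s + t)
          = Poly_Mapping.lookup P s * Poly_Mapping.lookup Q t"
    by (simp add: lookup_mult_group)
  have "e * k \<le> e * (s + t)" if "Poly_Mapping.lookup (P * Q) k \<noteq> 0" for k
  proof -
    have "k \<in> Poly_Mapping.keys (P * Q)"
      using that by (simp add: in_keys_iff)
    with keys_mult[of P Q] obtain x y
      where "x \<in> Poly_Mapping.keys P" "y \<in> Poly_Mapping.keys Q" "k = x + y"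
      by blast
    with assms show ?thesis
      by (auto simp: extremal_def in_keys_iff distrib_left intro: add_mono)
  qed
  with * assms show "extremal e (P * Q) (s + t)"
    by (simp add: extremal_def)
qed

section \<open>Powers of q and substitutions in x\<close>

text \<open>Here it enters that q is not a root of unity: an equation between powers of q becomes an
  equation between exponents.\<close>

lemma powi_inj:
  fixes q :: "'a::field"
  assumes "q \<noteq> 0" "\<forall>k::nat. k > 0 \<longrightarrow> q ^ k \<noteq> 1" "q powi s = q powi t"
  shows "s = t"
proof -
  \<comment> \<open>By symmetry one inequality suffices; if \<open>s\<close> exceeded
    \<open>t\<close>, the positive power \<open>q ^ nat (s - t)\<close> would be 1.\<close>
  have *: "s \<le> t" if "q powi s = q powi t" for s t
  proof (rule ccontr)
    assume "\<not> s \<le> t"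
    then have "q ^ nat (s - t) = q powi (s - t)"
      by (simp add: power_int_nonneg_exp)
    also have "\<dots> = 1"
      using that assms(1) by (simp add: power_int_diff)
    finally show False
      using assms(2) \<open>\<not> s \<le> t\<close> by simp
  qed
  from *[OF assms(3)] *[OF assms(3)[symmetric]] show ?thesis by simp
qed

lemma lookup_laurent_of_poly_x_scale:
  fixes c :: "'a::field"
  shows "Poly_Mapping.lookup (laurent_of_poly (x_scale c P)) k
           = Polynomial.smult (c powi k) (Poly_Mapping.lookup (laurent_of_poly P) k)"
  by (auto simp: lookup_laurent_of_poly x_scale_def coeff_pcompose_linear power_int_nonneg_exp)

lemma extremal_x_scale:
  fixes c :: "'a::field"
  assumes "c \<noteq> 0"
  shows "extremal e (laurent_of_poly (x_scale c P)) s \<longleftrightarrow> extremal e (laurent_of_poly P) s"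
  by (rule extremal_cong) (use assms in \<open>simp add: lookup_laurent_of_poly_x_scale\<close>)

lemma laurent_of_poly_eq_0_iff: "laurent_of_poly P = 0 \<longleftrightarrow> P = 0"
proof
  assume *: "laurent_of_poly P = 0"
  show "P = 0"
  proof (rule poly_eqI)
    fix i
    show "poly.coeff P i = poly.coeff 0 i"
      using arg_cong[OF *, of "\<lambda>Q. Poly_Mapping.lookup Q (int i)"]
      by (simp add: lookup_laurent_of_poly)
  qed
qed (simp add: poly_mapping_eq_iff fun_eq_iff lookup_laurent_of_poly)

section \<open>End coefficients of a Gosper representation\<close>

text \<open>Clearing denominators gives b B C = A C(q^m x) b(q^m x). The substitution keeps all ends
  fixed and multiplies the end coefficients of b and C by q^(m l0) and q^(m l2); comparing end terms
  then relates A to B.\<close>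

lemma q_gosper_rep_extremal:
  fixes q :: "'a::field"
  assumes "q \<noteq> 0" "b \<noteq> 0" "q_gosper_rep q m b A B C" "e \<noteq> 0"
    and b: "extremal e (laurent_of_poly b) l0"
    and A: "extremal e (laurent_of_poly A) l1"
    and C: "extremal e (laurent_of_poly C) l2"
  shows "extremal e (laurent_of_poly B) l1"
    and "Poly_Mapping.lookup (laurent_of_poly B) l1
           = Polynomial.smult (q powi (int m * (l0 + l2))) (Poly_Mapping.lookup (laurent_of_poly A) l1)"
proof -
  let ?s = "x_scale (q ^ m)" and ?L = laurent_of_poly
  have "B \<noteq> 0" "C \<noteq> 0" and fract: "Fract b (?s b) = Fract (A * ?s C) (B * C)"
    using assms(3) by (auto simp: q_gosper_rep_def)
  have scale: "?s b \<noteq> 0"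
    using assms(1,2) by (simp add: x_scale_def pcompose_eq_0_iff)
  obtain lB where B: "extremal e (?L B) lB"
    using extremal_exists \<open>B \<noteq> 0\<close> by (metis laurent_of_poly_eq_0_iff)
  have "b * (B * C) = (A * ?s C) * ?s b"
    using fract scale \<open>B \<noteq> 0\<close> \<open>C \<noteq> 0\<close> by (simp add: eq_fract)
  then have L: "?L b * (?L B * ?L C) = (?L A * ?L (?s C)) * ?L (?s b)"
    by (metis laurent_of_poly_mult)
  have sb: "extremal e (?L (?s b)) l0" and sC: "extremal e (?L (?s C)) l2"
    using b C assms(1) by (simp_all add: extremal_x_scale)
  note BC = extremal_mult[OF \<open>e \<noteq> 0\<close> B C]
  note lhs = extremal_mult[OF \<open>e \<noteq> 0\<close> b BC(2)]
  note AC = extremal_mult[OF \<open>e \<noteq> 0\<close> A sC]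
  note rhs = extremal_mult[OF \<open>e \<noteq> 0\<close> AC(2) sb]
  \<comment> \<open>Both sides are the same Laurent polynomial, so their ends coincide;
    \<open>l0\<close> and \<open>l2\<close> then cancel.\<close>
  have idx: "l0 + (lB + l2) = l1 + l2 + l0"
    using extremal_unique[OF \<open>e \<noteq> 0\<close> lhs(2)] rhs(2) L by simp
  then have lB: "lB = l1" by simp
  with B show "extremal e (?L B) l1" by simp
  let ?b = "Poly_Mapping.lookup (?L b) l0" and ?C = "Poly_Mapping.lookup (?L C) l2"
  have "?b * (Poly_Mapping.lookup (?L B) l1 * ?C)
      = Poly_Mapping.lookup (?L A) l1 * Polynomial.smult ((q ^ m) powi l2) ?C
          * Polynomial.smult ((q ^ m) powi l0) ?b"
  proof -
    have "Poly_Mapping.lookup (?L b * (?L B * ?L C)) (l0 + (lB + l2))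
        = Poly_Mapping.lookup ((?L A * ?L (?s C)) * ?L (?s b)) (l1 + l2 + l0)"
      by (simp only: L idx)
    then show ?thesis
      unfolding lhs(1) BC(1) rhs(1) AC(1) unfolding lookup_laurent_of_poly_x_scale lB .
  qed
  \<comment> \<open>The two scaling factors merge into one power of \<open>q\<close>, and the
    nonzero product \<open>?b * ?C\<close> is isolated for cancellation.\<close>
  then have "(?b * ?C) * Poly_Mapping.lookup (?L B) l1 = (?b * ?C) *
      Polynomial.smult (q powi (int m * (l0 + l2))) (Poly_Mapping.lookup (?L A) l1)"
    using assms(1) by (simp add: power_int_power power_int_add distrib_left mult_ac)
  moreover have "?b * ?C \<noteq> 0"
    using b C by (simp add: extremal_def)
  ultimately show "Poly_Mapping.lookup (?L B) l1
      = Polynomial.smult (q powi (int m * (l0 + l2))) (Poly_Mapping.lookup (?L A) l1)"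
    using mult_left_cancel by blast
qed

section \<open>End terms of the key equation\<close>

lemma degree_lookup_le_y_degree: "Polynomial.degree (Poly_Mapping.lookup p k) \<le> y_degree p"
proof (cases "k \<in> Poly_Mapping.keys p")
  case True
  then show ?thesis
    unfolding y_degree_def
    by (intro cSUP_upper) (auto intro: bdd_above_finite)
qed (simp add: in_keys_iff)

text \<open>Either the extremal coefficients of the two products on the right-hand side do not cancel,
  and then the extremal degree of the right-hand side is that of the left-hand side, or comparing
  leading coefficients in \<open>y\<close> of degree \<open>d\<close> yields an equation between powers of \<open>q\<close>.\<close>

lemma q_gosper_equation_extremal:
  fixes q :: "'a::field" and p :: "'a laurent"
  assumes q: "q \<noteq> 0" "\<forall>k::nat. k > 0 \<longrightarrow> q ^ k \<noteq> 1"
    and "b \<noteq> 0" "q_gosper_rep q m b A B C" "e \<noteq> 0"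
    and b: "extremal e (laurent_of_poly b) l0"
    and A: "extremal e (laurent_of_poly A) l1"
    and C: "extremal e (laurent_of_poly C) l2"
    and p: "extremal e p l" and deg: "y_degree p < lam"
    and eq: "F * laurent_of_poly C =
           laurent_of_poly (Polynomial.smult (q powi (- (v * int j))) A)
             * laurent_scale (q ^ m) (q powi (- n)) p
           - laurent_of_poly (x_scale (q powi (- int m)) B) * p"
  shows "(\<exists>l3. extremal e F l3 \<and> e * (l + l1) \<le> e * (l2 + l3))
       \<or> (\<exists>d. 0 \<le> d \<and> d \<le> int lam - 1 \<and> int m * l = int m * (l0 - l1 + l2) + v * int j + n * d)"
proof -
  let ?L = laurent_of_poly
  let ?A = "?L (Polynomial.smult (q powi (- (v * int j))) A)"
  let ?B = "?L (x_scale (q powi (- int m)) B)"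
  let ?p = "laurent_scale (q ^ m) (q powi (- n)) p"
  note B = q_gosper_rep_extremal[OF q(1) assms(3-5) b A C]
  have lookA: "Poly_Mapping.lookup ?A k
      = Polynomial.smult (q powi (- (v * int j))) (Poly_Mapping.lookup (?L A) k)" for k
    by (simp add: lookup_laurent_of_poly)
  have exA: "extremal e ?A l1"
    using A extremal_cong[of ?A "?L A"] q(1) by (simp add: lookA)
  have exB: "extremal e ?B l1"
    using B(1) q(1) by (simp add: extremal_x_scale)
  have "pcompose (Poly_Mapping.lookup p k) [:0, q powi (- n):] = 0
      \<longleftrightarrow> Poly_Mapping.lookup p k = 0" for k
    using q(1) by (simp add: pcompose_eq_0_iff)
  then have exp: "extremal e ?p l"
    using p extremal_cong[of ?p p] q(1) by (simp add: lookup_laurent_scale)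
  note Ap = extremal_mult[OF \<open>e \<noteq> 0\<close> exA exp]
  note Bp = extremal_mult[OF \<open>e \<noteq> 0\<close> exB p]
  \<comment> \<open>Both products on the right end at the same exponent \<open>l1 + l\<close>; all
    depends on whether their coefficients there cancel.\<close>
  have F: "Poly_Mapping.lookup (F * ?L C) (l1 + l)
      = Poly_Mapping.lookup ?A l1 * Poly_Mapping.lookup ?p l
        - Poly_Mapping.lookup ?B l1 * Poly_Mapping.lookup p l"
    by (simp add: eq lookup_minus Ap(1) Bp(1))
  show ?thesis
  proof (cases "Poly_Mapping.lookup (F * ?L C) (l1 + l) = 0")
    case False
    then have "F \<noteq> 0" by auto
    then obtain l3 where l3: "extremal e F l3"
      using extremal_exists by blast
    \<comment> \<open>The exponent \<open>l1 + l\<close> lies in the support of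
      \<open>F * ?L C\<close>, whose end is \<open>l3 + l2\<close>.\<close>
    from extremal_mult(2)[OF \<open>e \<noteq> 0\<close> l3 C] False
    have "e * (l1 + l) \<le> e * (l3 + l2)"
      by (simp add: extremal_def)
    with l3 show ?thesis
      by (metis add.commute)
  next
    case True
    let ?pl = "Poly_Mapping.lookup p l"
    let ?d = "Polynomial.degree ?pl"
    \<comment> \<open>The end coefficient of \<open>A\<close> is constant in y; \<open>x\<close>
      names this scalar, not the indeterminate.\<close>
    define x where "x = poly.coeff A (nat l1)"
    have "l1 \<ge> 0" "x \<noteq> 0"
      using A by (auto simp: extremal_def lookup_laurent_of_poly x_def split: if_splits)
    have lA: "Poly_Mapping.lookup (?L A) l1 = [:x:]"
      using \<open>l1 \<ge> 0\<close> by (simp add: lookup_laurent_of_poly x_def)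
    have c: "poly.coeff ?pl ?d \<noteq> 0"
      using p by (simp add: extremal_def)
    have "Poly_Mapping.lookup ?A l1 * Poly_Mapping.lookup ?p l
        = Poly_Mapping.lookup ?B l1 * ?pl"
      using True F by simp
    then have "poly.coeff (Poly_Mapping.lookup ?A l1 * Poly_Mapping.lookup ?p l) ?d
        = poly.coeff (Poly_Mapping.lookup ?B l1 * ?pl) ?d"
      by simp
    \<comment> \<open>On the left, x -> q^m x contributes q^(m l) and y -> q^(-n) y contributes
      q^(-n ?d). On the right, the scaling of \<open>B\<close> contributes q^(-m l1) and the Gosper
      relation q^(m (l0 + l2)).\<close>
    then have "q powi (- (v * int j)) * (x * ((q ^ m) powi l * ((q powi (- n)) ^ ?d
          * poly.coeff ?pl ?d)))
        = (q powi (- int m)) powi l1 * (q powi (int m * (l0 + l2)) * (x * poly.coeff ?pl ?d))"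
      by (simp add: lookA lA lookup_laurent_scale lookup_laurent_of_poly_x_scale B(2)
          coeff_pcompose_linear mult_ac)
    then have "(x * poly.coeff ?pl ?d) * (q powi (- (v * int j)) * (q ^ m) powi l * (q powi (- n)) ^ ?d)
        = (x * poly.coeff ?pl ?d) * ((q powi (- int m)) powi l1 * q powi (int m * (l0 + l2)))"
      by (simp only: mult_ac)
    \<comment> \<open>The nonzero common factor drops out, leaving an equation purely between powers
      of \<open>q\<close>.\<close>
    then have "q powi (- (v * int j)) * (q ^ m) powi l * (q powi (- n)) ^ ?d
        = (q powi (- int m)) powi l1 * q powi (int m * (l0 + l2))"
      using c \<open>x \<noteq> 0\<close> by (metis mult_eq_0_iff mult_left_cancel)
    then have "q powi (- (v * int j) + int m * l + (- n) * int ?d)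
        = q powi ((- int m) * l1 + int m * (l0 + l2))"
      using q(1) by (simp only: power_int_power power_int_power' power_int_add power_int_mult
          simp_thms)
    then have "- (v * int j) + int m * l + (- n) * int ?d = (- int m) * l1 + int m * (l0 + l2)"
      by (rule powi_inj[OF q])
    then have "int m * l = int m * (l0 - l1 + l2) + v * int j + n * int ?d"
      by (simp add: algebra_simps)
    moreover have "int ?d \<le> int lam - 1"
      using degree_lookup_le_y_degree[of p l] deg by linarith
    ultimately show ?thesis
      by (intro disjI2 exI[of _ "int ?d"]) simp
  qed
qed

section \<open>The two degree bounds\<close>

text \<open>Since \<open>n * d\<close> is monotone in \<open>d\<close>, it lies between its values
  at 0 and \<open>D\<close> whatever the sign of \<open>n\<close>. This eliminates the unknown
  y-degree and produces the two entries with vj and vj + n(lam - 1).\<close>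

lemma mult_between_endpoints:
  fixes n :: "'a::linordered_idom"
  assumes "0 \<le> d" "d \<le> D"
  shows "n * d \<le> max 0 (n * D)" "min 0 (n * D) \<le> n * d"
proof -
  have "n * d \<le> max 0 (n * D) \<and> min 0 (n * D) \<le> n * d"
  proof (cases "n \<ge> 0")
    case True
    with assms have "0 \<le> n * d" "n * d \<le> n * D"
      by (auto intro: mult_left_mono)
    then show ?thesis by auto
  next
    case False
    with assms have "n * d \<le> 0" "n * D \<le> n * d"
      by (auto intro: mult_left_mono_neg mult_nonpos_nonneg)
    then show ?thesis by auto
  qed
  then show "n * d \<le> max 0 (n * D)" "min 0 (n * D) \<le> n * d" by auto
qed

theorem theorem4p2:
  fixes q :: "'a::field_char_0"
    and b A B C :: "'a poly"
    and a :: "'a poly poly"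
    and m j lam :: nat
    and n v l l' :: int
    and p :: "'a laurent"
  assumes "q \<noteq> 0"
    and "\<forall>k::nat. k > 0 \<longrightarrow> q ^ k \<noteq> 1"
    and "b \<noteq> 0"
    and "m > 0" and "j > 0" and "lam > 0"
    and "y_degree (laurent_of_poly2 a) < lam"
    and "q_gosper_rep q m b A B C"
    and "Poly_Mapping.keys p \<subseteq> {l'..l}"
    and "Poly_Mapping.lookup p l \<noteq> 0"
    and "Poly_Mapping.lookup p l' \<noteq> 0"
    and "y_degree p < lam"
    and "laurent_of_poly2 a * laurent_of_poly C =
           laurent_of_poly (Polynomial.smult (q powi (- (v * int j))) A)
             * laurent_scale (q ^ m) (q powi (- n)) p
           - laurent_of_poly (x_scale (q powi (- int m)) B) * p"
  defines "L0 \<equiv> x_highdeg (laurent_of_poly b)"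
    and "L1 \<equiv> x_highdeg (laurent_of_poly A)"
    and "L2 \<equiv> x_highdeg (laurent_of_poly C)"
    and "L3 \<equiv> x_highdeg (laurent_of_poly2 a)"
    and "M0 \<equiv> x_lowdeg (laurent_of_poly b)"
    and "M1 \<equiv> x_lowdeg (laurent_of_poly A)"
    and "M2 \<equiv> x_lowdeg (laurent_of_poly C)"
    and "M3 \<equiv> x_lowdeg (laurent_of_poly2 a)"
  shows "ereal (of_int l) \<le>
           Max {L2 + L3 - L1,
                L0 - L1 + L2 + ereal (of_int (v * int j) / of_nat m),
                L0 - L1 + L2 + ereal (of_int (v * int j + n * (int lam - 1)) / of_nat m)}
       \<and> Min {M2 + M3 - M1,
              M0 - M1 + M2 + ereal (of_int (v * int j) / of_nat m),
              M0 - M1 + M2 + ereal (of_int (v * int j + n * (int lam - 1)) / of_nat m)}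
           \<le> ereal (of_int l')"
proof -
  have "C \<noteq> 0" using assms(8) by (simp add: q_gosper_rep_def)
  \<comment> \<open>The ends of \<open>A\<close> exist only if it is nonzero; a zero
    \<open>A\<close> would make the fraction b / b(q^m x) vanish.\<close>
  have "A \<noteq> 0"
  proof
    assume "A = 0"
    then have "Fract b (x_scale (q ^ m) b) = 0"
      using assms(8) by (simp add: q_gosper_rep_def fract_collapse)
    moreover have "x_scale (q ^ m) b \<noteq> 0"
      using assms(1,3) by (simp add: x_scale_def pcompose_eq_0_iff)
    ultimately show False
      using assms(3) by (simp add: Zero_fract_def eq_fract)
  qed
  have nz: "laurent_of_poly b \<noteq> 0" "laurent_of_poly A \<noteq> 0" "laurent_of_poly C \<noteq> 0"
    using \<open>A \<noteq> 0\<close> \<open>C \<noteq> 0\<close> assms(3) by (simp_all add: laurent_of_poly_eq_0_iff)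
  have p: "extremal 1 p l" "extremal (- 1) p l'"
    using assms(9-11) by (auto simp: extremal_def simp flip: in_keys_iff)
  define M where "M = real m"
  have "M > 0" using assms(4) by (simp add: M_def)
  \<comment> \<open>The witness is \<open>t = v * int j + n * d\<close>, after division by
    \<open>m\<close>. The exponents are left general so that both ends of \<open>p\<close> can use
    this.\<close>
  have between: "\<exists>t. of_int l = of_int (l0 - l1 + l2) + t / M \<and>
      t \<le> max (of_int (v * int j)) (of_int (v * int j + n * (int lam - 1))) \<and>
      min (of_int (v * int j)) (of_int (v * int j + n * (int lam - 1))) \<le> t"
    if d: "0 \<le> d" "d \<le> int lam - 1"
      and eq: "int m * l = int m * (l0 - l1 + l2) + v * int j + n * d"
    for l l0 l1 l2 d
  proof (intro exI conjI)
    have "M * of_int l = M * of_int (l0 - l1 + l2) + of_int (v * int j + n * d)"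
      using arg_cong[OF eq, of real_of_int] by (simp add: M_def)
    then show "real_of_int l = of_int (l0 - l1 + l2) + of_int (v * int j + n * d) / M"
      using \<open>M > 0\<close> by (simp add: field_simps)
    from mult_between_endpoints[OF d, of n]
    have "v * int j + n * d \<le> max (v * int j) (v * int j + n * (int lam - 1))"
      "min (v * int j) (v * int j + n * (int lam - 1)) \<le> v * int j + n * d"
      by linarith+
    then show "of_int (v * int j + n * d)
        \<le> max (real_of_int (v * int j)) (of_int (v * int j + n * (int lam - 1)))"
      "min (real_of_int (v * int j)) (of_int (v * int j + n * (int lam - 1)))
        \<le> of_int (v * int j + n * d)"
      unfolding of_int_max[symmetric] of_int_min[symmetric] of_int_le_iff .
  qed
  have sign: "(1::int) \<noteq> 0" "(- 1::int) \<noteq> 0" by simp_all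
  \<comment> \<open>The sign and the end exponents stay open, to be filled with \<open>e = 1\<close>
    for the upper and \<open>e = -1\<close> for the lower bound.\<close>
  note main = q_gosper_equation_extremal[OF assms(1-3,8) _ _ _ _ _ assms(12,13)]
  obtain l0 l1 l2 where h: "extremal 1 (laurent_of_poly b) l0"
      "extremal 1 (laurent_of_poly A) l1" "extremal 1 (laurent_of_poly C) l2"
    using nz extremal_exists by metis
  have L: "L0 = ereal (of_int l0)" "L1 = ereal (of_int l1)" "L2 = ereal (of_int l2)"
    using h by (simp_all add: L0_def L1_def L2_def x_highdeg_extremal)
  from main[OF sign(1) h p(1)] have "ereal (of_int l) \<le>
           Max {L2 + L3 - L1,
                L0 - L1 + L2 + ereal (of_int (v * int j) / of_nat m),
                L0 - L1 + L2 + ereal (of_int (v * int j + n * (int lam - 1)) / of_nat m)}"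
  proof (elim disjE exE conjE)
    \<comment> \<open>Here \<open>a\<close> has an end exponent, so \<open>L3\<close> is finite and
      the first entry of the maximum gives the bound.\<close>
    fix l3 assume "extremal 1 (laurent_of_poly2 a) l3" and le: "1 * (l + l1) \<le> 1 * (l2 + l3)"
    then have "L3 = ereal (of_int l3)"
      by (simp add: L3_def x_highdeg_extremal)
    moreover have "real_of_int l \<le> of_int (l2 + l3 - l1)"
      using le unfolding of_int_le_iff by simp
    ultimately show ?thesis
      by (simp add: L le_max_iff_disj)
  next
    \<comment> \<open>Here \<open>a\<close> may be zero, with \<open>L3\<close> equal to
      -\<infinity>; the bound comes from one of the other two entries.\<close>
    fix d assume "0 \<le> d" "d \<le> int lam - 1"
      "int m * l = int m * (l0 - l1 + l2) + v * int j + n * d"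
    from between[OF this] obtain t where
      t: "of_int l = of_int (l0 - l1 + l2) + t / M"
        "t \<le> max (of_int (v * int j)) (of_int (v * int j + n * (int lam - 1)))" by blast
    from t(2) \<open>M > 0\<close> have "t / M \<le> of_int (v * int j) / M
        \<or> t / M \<le> of_int (v * int j + n * (int lam - 1)) / M"
      by (auto simp: le_max_iff_disj intro: divide_right_mono)
    with t(1) show ?thesis
      by (auto simp: L le_max_iff_disj M_def)
  qed
  moreover
  obtain m0 m1 m2 where h': "extremal (- 1) (laurent_of_poly b) m0"
      "extremal (- 1) (laurent_of_poly A) m1" "extremal (- 1) (laurent_of_poly C) m2"
    using nz extremal_exists by metis
  have M': "M0 = ereal (of_int m0)" "M1 = ereal (of_int m1)" "M2 = ereal (of_int m2)"
    using h' by (simp_all add: M0_def M1_def M2_def x_lowdeg_extremal)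
  from main[OF sign(2) h' p(2)] have "Min {M2 + M3 - M1,
              M0 - M1 + M2 + ereal (of_int (v * int j) / of_nat m),
              M0 - M1 + M2 + ereal (of_int (v * int j + n * (int lam - 1)) / of_nat m)}
           \<le> ereal (of_int l')"
  proof (elim disjE exE conjE)
    fix l3 assume "extremal (- 1) (laurent_of_poly2 a) l3"
      and le: "- 1 * (l' + m1) \<le> - 1 * (m2 + l3)"
    then have "M3 = ereal (of_int l3)"
      by (simp add: M3_def x_lowdeg_extremal)
    \<comment> \<open>The factor -1 reverses the inequality, turning it into a lower bound for
      \<open>l'\<close>.\<close>
    moreover have "of_int (m2 + l3 - m1) \<le> real_of_int l'"
      using le unfolding of_int_le_iff by simp
    ultimately show ?thesis
      by (simp add: M' min_le_iff_disj)
  next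
    \<comment> \<open>Dually, \<open>M3\<close> may be \<infinity> here, and one of the last two
      entries of the minimum lies below \<open>l'\<close>.\<close>
    fix d assume "0 \<le> d" "d \<le> int lam - 1"
      "int m * l' = int m * (m0 - m1 + m2) + v * int j + n * d"
    from between[OF this] obtain t where
      t: "of_int l' = of_int (m0 - m1 + m2) + t / M"
        "min (of_int (v * int j)) (of_int (v * int j + n * (int lam - 1))) \<le> t" by blast
    from t(2) \<open>M > 0\<close> have "of_int (v * int j) / M \<le> t / M
        \<or> of_int (v * int j + n * (int lam - 1)) / M \<le> t / M"
      by (auto simp: min_le_iff_disj intro: divide_right_mono)
    with t(1) show ?thesis
      by (auto simp: M' min_le_iff_disj M_def)
  qed
  ultimately show ?thesis by blast
qed

end
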